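(* Let $\epsilon>0$ and $\delta\in(0,1)$. Let $(\mathbf{h}_t)_{t\ge 0}$ be the sequence of layer outputs of the unrolled proximal gradient descent network with parameters $\mathbf{W}$, where $\mathbf{h}$ denotes the (random) ground-truth channel. Suppose that Assumptions 1--5 listed in the context hold, and that there exists a near-optimal solution $\mathbf{W}$ of the constrained learning problem $$P=\min_{\mathbf{W}}\ \mathbb{E}\left[\ell(\boldsymbol{\Phi}(\mathbf{y};\mathbf{W}),\mathbf{h})\right]\quad\text{s.t.}\quad \mathbb{E}\left[\mathcal{C}(\mathbf{h}_t,\mathbf{h}_{t-1})\right]\le 0\ \text{ for every layer } t,$$ which satisfies the monotonic descent constraint $$\mathcal{C}(\mathbf{h}_t,\mathbf{h}_{t-1})=\|\mathbf{h}_t-\mathbf{h}\|_2-(1-\epsilon)\|\mathbf{h}_{t-1}-\mathbf{h}\|_2\le 0$$ with probability $1-\delta$ at each layer $t\ge 1$. Let $C$ be a constant such that $\|\mathbf{h}_t-\mathbf{h}\|_2\le C$ for all $t$ (such a bound is part of the boundedness in Assumption 1). Then the sequence of outputs of the network with these parameters satisfies $$\lim_{t\to\infty}\mathbb{E}\left[\min_{k\le t}\|\mathbf{h}_k-\mathbf{h}\|_2\right]\le\frac{1}{\epsilon}\left(\zeta(J,\delta)+\frac{\delta C}{1-\delta}\right)\quad\text{almost surely},$$ where $\zeta(J,\delta)\ge 0$ is the sample-complexity function of Assumption 4 and $J$ is the number of training samples.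
   Context: Setting. The measurement is $\mathbf{y}=\mathbf{A}\mathbf{h}+\mathbf{n}$, where $\mathbf{A}$ is a known matrix, $\mathbf{h}$ is a random channel vector taking values in a set $\mathcal{H}$, and $\mathbf{n}$ is Gaussian noise. All random variables live on one probability space with probability measure also denoted $P$, and $\mathbb{E}$ is the expectation on it. The outputs $\mathbf{h}_t$ are adapted to a filtration $\{\mathcal{F}_t\}$. Unrolled network. Given an initial $\mathbf{h}_0$, the layer $t\ge 1$ computes $\mathbf{h}_t=\phi_t(\mathbf{h}_{t-1}+\mathbf{n}_t;\mathbf{W}_t)$, where $\mathbf{n}_t\sim\mathcal{N}(0,\sigma_t^2\mathbf{I})$ is injected noise with $\sigma_t^2$ decreasing in $t$. The map $\phi_t(\mathbf{x};\mathbf{W}_t)=\mathcal{N}_{\theta_t}\left(\mathbf{x}-\alpha_t\mathbf{A}^T(\mathbf{A}\mathbf{x}-\mathbf{y})\right)$ has trainable parameters $\mathbf{W}_t=(\theta_t,\alpha_t)$: a step size $\alpha_t$ and a neural network $\mathcal{N}_{\theta_t}$ with weights $\theta_t$. For a network with $T$ layers, $\mathbf{W}=(\mathbf{W}_t)_{t=1}^T$ and $\boldsymbol{\Phi}(\mathbf{y};\mathbf{W})=\mathbf{h}_T$. The loss $\ell(\cdot,\cdot)$ is the $\ell_2$ estimation error between estimated and true channel. For the limit $t\to\infty$ the number of layers is unbounded, and the assumptions are understood to hold for all layers. Empirical quantities. $\widehat{\mathbb{E}}$ is the sample mean over $J$ training samples. Put $\mathcal{L}(\mathbf{W},\boldsymbol{\lambda})=\mathbb{E}[\ell(\boldsymbol{\Phi}(\mathbf{y};\mathbf{W}),\mathbf{h})]+\sum_{t=1}^T\lambda_t\mathbb{E}[\mathcal{C}(\mathbf{h}_t,\mathbf{h}_{t-1})]$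 for $\boldsymbol{\lambda}\in\mathbb{R}_+^T$, let $\widehat{\mathcal{L}}$ be the same expression with $\widehat{\mathbb{E}}$ in place of $\mathbb{E}$, and let $\widehat{D}=\max_{\boldsymbol{\lambda}\in\mathbb{R}_+^T}\min_{\mathbf{W}}\widehat{\mathcal{L}}(\mathbf{W},\boldsymbol{\lambda})$. Near-optimal solution. $\mathbf{W}$ is near-optimal for the constrained problem if it is part of a stationary point $(\mathbf{W},\boldsymbol{\lambda}^* )$ of the problem defining $\widehat{D}$ for which, with probability $1-\delta$, $|P-\widehat{D}|\le I\nu+\gamma\zeta(J,\delta)$ and $\mathbb{E}[\mathcal{C}(\mathbf{h}_t,\mathbf{h}_{t-1})]\le\zeta(J,\delta)$ for all $t$. Here $P$ is the optimal value of the constrained problem, $\gamma\ge\max\{\|\boldsymbol{\lambda}^*\|,\|\overline{\boldsymbol{\lambda}}^*\|\}$ and $\overline{\boldsymbol{\lambda}}^*=\operatorname{argmax}_{\boldsymbol{\lambda}}\min_{\mathbf{W}}\mathcal{L}(\mathbf{W},\boldsymbol{\lambda})$. Assumption 1. The functions $\ell(\cdot,\mathbf{h})$ and $\mathcal{C}(\cdot,\mathbf{h})$ are bounded and $I$-Lipschitz continuous for all $\mathbf{h}$; in particular the distances $\|\mathbf{h}_t-\mathbf{h}\|_2$ are bounded by a constant $C$. Assumption 2. Let $\mathcal{P}_t$ be the set of compositions $\phi_t\circ\cdots\circ\phi_1$ of $t$ unrolled layers and $\overline{\mathcal{P}}_t=\overline{\operatorname{conv}}(\mathcal{P}_t)$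 its (closed) convex hull. For each $\bar\phi_t\circ\cdots\circ\bar\phi_1\in\overline{\mathcal{P}}_t$ and $\nu>0$ there exist parameters $\mathbf{W}_{1:t}$ such that $\mathbb{E}\left[\left|\phi_t\circ\cdots\circ\phi_1(\mathbf{x};\mathbf{W}_{1:t})-\bar\phi_t\circ\cdots\circ\bar\phi_1(\mathbf{x})\right|\right]\le\nu$. Assumption 3. $\mathcal{H}$ is compact and the conditional distribution $p(\mathbf{y}|\mathbf{h})$ is non-atomic for every $\mathbf{h}$. For $\boldsymbol{\Phi}\in\overline{\mathcal{P}}_t$, $t\le T$, the maps $\mathbf{h}\mapsto\ell(\boldsymbol{\Phi}(\cdot),\mathbf{h})p(\cdot|\mathbf{h})$ and $\mathbf{h}\mapsto\mathcal{C}(\boldsymbol{\Phi}(\cdot),\mathbf{h})p(\cdot|\mathbf{h})$ are uniformly continuous in the total variation topology. Assumption 4. $\zeta(J,\delta)\ge 0$ is a function decreasing monotonically in the number of samples $J$ such that, with probability $1-\delta$, $|\mathbb{E}[\ell(\boldsymbol{\Phi}(\mathbf{y};\mathbf{W}),\mathbf{h})]-\widehat{\mathbb{E}}[\ell(\boldsymbol{\Phi}(\mathbf{y};\mathbf{W}),\mathbf{h})]|\le\zeta(J,\delta)$ and $|\mathbb{E}[\mathcal{C}(\mathbf{h}_t,\mathbf{h}_{t-1})]-\widehat{\mathbb{E}}[\mathcal{C}(\mathbf{h}_t,\mathbf{h}_{t-1})]|\le\zeta(J,\delta)$ for all $t\le T$. Assumption 5. There is a strictly feasible $\boldsymbol{\Phi}\in\mathcal{P}_T$,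 i.e. one for which, for some $\xi>0$ and all $t\le T$, $\mathbb{E}[\mathcal{C}(\mathbf{h}_t,\mathbf{h}_{t-1})]\le -I\nu-\xi$ and $\widehat{\mathbb{E}}[\mathcal{C}(\mathbf{h}_t,\mathbf{h}_{t-1})]\le-\xi$. *)

theory Defs
  imports "HOL-Probability.Probability"
begin

definition std_gaussian :: "'a::euclidean_space measure" where
  "std_gaussian = density lborel (\<lambda>x. ennreal (\<Prod>b\<in>Basis. std_normal_density (x \<bullet> b)))"

text \<open>An affine image of a standard Gaussian vector; the matrix of \<open>L\<close> is a square root of the
  covariance, so degenerate covariances are included.\<close>

definition gaussian :: "'a \<Rightarrow> ('a \<Rightarrow> 'a) \<Rightarrow> 'a::euclidean_space measure" where
  "gaussian \<mu> L = distr std_gaussian borel (\<lambda>z. \<mu> + L z)"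

definition is_gaussian :: "'a::euclidean_space measure \<Rightarrow> bool" where
  "is_gaussian Q \<longleftrightarrow> (\<exists>\<mu> L. linear L \<and> Q = gaussian \<mu> L)"

definition isotropic_gaussian :: "real \<Rightarrow> 'a::euclidean_space measure" where
  "isotropic_gaussian \<sigma> = gaussian 0 (\<lambda>z. \<sigma> *\<^sub>R z)"

text \<open>The event is existentially quantified so that \<open>Q\<close> itself need not define a measurable set.\<close>

definition with_prob :: "'w measure \<Rightarrow> real \<Rightarrow> ('w \<Rightarrow> bool) \<Rightarrow> bool" where
  "with_prob M p Q \<longleftrightarrow> (\<exists>E\<in>sets M. p \<le> measure M E \<and> (\<forall>\<omega>\<in>E. Q \<omega>))"

definition nonatomic :: "'a measure \<Rightarrow> bool" where
  "nonatomic Q \<longleftrightarrow>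
     (\<forall>S\<in>sets Q. 0 < emeasure Q S \<longrightarrow>
        (\<exists>R\<in>sets Q. R \<subseteq> S \<and> 0 < emeasure Q R \<and> emeasure Q R < emeasure Q S))"

definition cond_distribution ::
  "'w measure \<Rightarrow> 'a measure \<Rightarrow> 'b measure \<Rightarrow> ('w \<Rightarrow> 'a) \<Rightarrow> ('w \<Rightarrow> 'b) \<Rightarrow> ('a \<Rightarrow> 'b measure) \<Rightarrow> bool" where
  "cond_distribution M MA MB X Y K \<longleftrightarrow>
     K \<in> MA \<rightarrow>\<^sub>M prob_algebra MB \<and>
     (\<forall>R\<in>sets MA. \<forall>S\<in>sets MB.
        measure M {\<omega>\<in>space M. X \<omega> \<in> R \<and> Y \<omega> \<in> S} =
        (\<integral>\<omega>. indicator R (X \<omega>) * measure (K (X \<omega>)) S \<partial>M))"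

definition total_variation :: "'a measure \<Rightarrow> ('a set \<Rightarrow> real) \<Rightarrow> ennreal" where
  "total_variation N m = (SUP \<P>\<in>{\<P>. finite \<P> \<and> disjoint \<P> \<and> \<P> \<subseteq> sets N}. \<Sum>S\<in>\<P>. ennreal \<bar>m S\<bar>)"

text \<open>Uniform continuity of \<open>g \<mapsto> f g \<cdot> K g\<close> as a map from \<open>H\<close> into the finite signed measures
  on \<open>N\<close> with the total variation norm.\<close>

definition tv_uniformly_continuous_on ::
  "'a::metric_space set \<Rightarrow> 'b measure \<Rightarrow> ('a \<Rightarrow> 'b measure) \<Rightarrow> ('a \<Rightarrow> 'b \<Rightarrow> real) \<Rightarrow> bool" where
  "tv_uniformly_continuous_on H N K f \<longleftrightarrow>
     (\<forall>g\<in>H. integrable (K g) (f g)) \<and>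
     (\<forall>e>0. \<exists>d>0. \<forall>g\<in>H. \<forall>g'\<in>H. dist g g' < d \<longrightarrow>
        total_variation N (\<lambda>S. (LINT x:S|K g. f g x) - (LINT x:S|K g'. f g' x)) < ennreal e)"

text \<open>The input of the network consists of the initial estimate, the measurement, and the sequence
  of noise vectors injected at the layers. A data point is a channel together with such an input.
  Layers, their parameters and their noise are numbered from 1; entry 0 is never used.\<close>

type_synonym ('n, 'm) input = "(real^'n) \<times> (real^'m) \<times> (nat \<Rightarrow> real^'n)"
type_synonym ('n, 'm) datum = "(real^'n) \<times> ('n, 'm) input"
type_synonym 'p params = "nat \<Rightarrow> 'p \<times> real"
type_synonym ('p, 'n, 'm) net = "'p params \<Rightarrow> nat \<Rightarrow> ('n, 'm) input \<Rightarrow> real^'n"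

definition input_space :: "('n::finite, 'm::finite) input measure" where
  "input_space = borel \<Otimes>\<^sub>M borel \<Otimes>\<^sub>M Pi\<^sub>M UNIV (\<lambda>_. borel)"

definition layer ::
  "('p \<Rightarrow> real^'n \<Rightarrow> real^'n) \<Rightarrow> real^'n^'m \<Rightarrow> real^'m \<Rightarrow> 'p \<times> real \<Rightarrow> real^'n \<Rightarrow> real^'n" where
  "layer N A y w x = N (fst w) (x - snd w *\<^sub>R (transpose A *v (A *v x - y)))"

primrec network ::
  "('p \<Rightarrow> real^'n \<Rightarrow> real^'n) \<Rightarrow> real^'n^'m \<Rightarrow> ('p, 'n, 'm) net" where
  "network N A W 0 = (\<lambda>(x0, y, \<eta>). x0)"
| "network N A W (Suc t) = (\<lambda>(x0, y, \<eta>).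
     layer N A y (W (Suc t)) (network N A W t (x0, y, \<eta>) + \<eta> (Suc t)))"

definition loss :: "real^'n \<Rightarrow> real^'n \<Rightarrow> real" where
  "loss x g = norm (x - g)"

text \<open>\<open>descent \<epsilon> g x x'\<close> is the constraint function at the current output \<open>x\<close> and the previous
  output \<open>x'\<close>; its dependence on the true channel \<open>g\<close> is made explicit.\<close>

definition descent :: "real \<Rightarrow> real^'n \<Rightarrow> real^'n \<Rightarrow> real^'n \<Rightarrow> real" where
  "descent \<epsilon> g x x' = norm (x - g) - (1 - \<epsilon>) * norm (x' - g)"

definition compositions :: "('p, 'n::finite, 'm) net \<Rightarrow> nat \<Rightarrow> (('n, 'm) input \<Rightarrow> real^'n) set" where
  "compositions net t = {net W t | W. True}"

definition conv_maps :: "('x \<Rightarrow> 'v::real_vector) set \<Rightarrow> ('x \<Rightarrow> 'v) set" where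
  "conv_maps F = {\<lambda>x. \<Sum>i<n. c i *\<^sub>R \<Phi> i x | (n::nat) c \<Phi>.
     (\<forall>i<n. \<Phi> i \<in> F \<and> 0 \<le> c i) \<and> (\<Sum>i<n. c i) = 1}"

text \<open>The closure is taken in mean, i.e. in \<open>L\<^sup>1\<close> of the law of the random input \<open>inp\<close>.\<close>

definition closed_conv_maps ::
  "'w measure \<Rightarrow> ('w \<Rightarrow> 'x) \<Rightarrow> 'x measure \<Rightarrow> ('x \<Rightarrow> 'v::euclidean_space) set \<Rightarrow> ('x \<Rightarrow> 'v) set" where
  "closed_conv_maps M inp N F = {\<Phi> \<in> borel_measurable N.
     \<forall>e>0. \<exists>\<Psi>\<in>conv_maps F. (\<integral>\<^sup>+\<omega>. ennreal (norm (\<Psi> (inp \<omega>) - \<Phi> (inp \<omega>))) \<partial>M) \<le> ennreal e}"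

definition population :: "'w measure \<Rightarrow> ('w \<Rightarrow> 'z) \<Rightarrow> ('z \<Rightarrow> real) \<Rightarrow> real" where
  "population M Z f = (\<integral>\<omega>. f (Z \<omega>) \<partial>M)"

definition empirical :: "nat \<Rightarrow> (nat \<Rightarrow> 'w \<Rightarrow> 'z) \<Rightarrow> 'w \<Rightarrow> ('z \<Rightarrow> real) \<Rightarrow> real" where
  "empirical J tr \<omega> f = (\<Sum>j<J. f (tr j \<omega>)) / real J"

text \<open>In the following \<open>E\<close> is either the population or the empirical mean, with the parameters \<open>W\<close>
  held fixed, and \<open>T\<close> is the number of layers.\<close>

definition risk :: "((('n, 'm) datum \<Rightarrow> real) \<Rightarrow> real) \<Rightarrow> ('p, 'n::finite, 'm) net \<Rightarrow> nat \<Rightarrow> 'p params \<Rightarrow> real" where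
  "risk E net T W = E (\<lambda>(g, x). loss (net W T x) g)"

definition slack ::
  "((('n, 'm) datum \<Rightarrow> real) \<Rightarrow> real) \<Rightarrow> ('p, 'n::finite, 'm) net \<Rightarrow> real \<Rightarrow> 'p params \<Rightarrow> nat \<Rightarrow> real" where
  "slack E net \<epsilon> W t = E (\<lambda>(g, x). descent \<epsilon> g (net W t x) (net W (t - 1) x))"

definition lagrangian ::
  "((('n, 'm) datum \<Rightarrow> real) \<Rightarrow> real) \<Rightarrow> ('p, 'n::finite, 'm) net \<Rightarrow> real \<Rightarrow> nat \<Rightarrow> 'p params \<Rightarrow> (nat \<Rightarrow> real) \<Rightarrow> real" where
  "lagrangian E net \<epsilon> T W lam = risk E net T W + (\<Sum>t=1..T. lam t * slack E net \<epsilon> W t)"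

text \<open>Vectors of length \<open>T\<close> are functions of which only the entries \<open>1..T\<close> matter.\<close>

definition multipliers :: "nat \<Rightarrow> (nat \<Rightarrow> real) set" where
  "multipliers T = {lam. \<forall>t\<in>{1..T}. 0 \<le> lam t}"

definition primal_value ::
  "((('n, 'm) datum \<Rightarrow> real) \<Rightarrow> real) \<Rightarrow> ('p, 'n::finite, 'm) net \<Rightarrow> real \<Rightarrow> nat \<Rightarrow> real" where
  "primal_value E net \<epsilon> T = (INF W\<in>{W. \<forall>t\<in>{1..T}. slack E net \<epsilon> W t \<le> 0}. risk E net T W)"

definition dual_function ::
  "((('n, 'm) datum \<Rightarrow> real) \<Rightarrow> real) \<Rightarrow> ('p, 'n::finite, 'm) net \<Rightarrow> real \<Rightarrow> nat \<Rightarrow> (nat \<Rightarrow> real) \<Rightarrow> real" where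
  "dual_function E net \<epsilon> T lam = (INF W. lagrangian E net \<epsilon> T W lam)"

definition dual_value ::
  "((('n, 'm) datum \<Rightarrow> real) \<Rightarrow> real) \<Rightarrow> ('p, 'n::finite, 'm) net \<Rightarrow> real \<Rightarrow> nat \<Rightarrow> real" where
  "dual_value E net \<epsilon> T = (SUP lam\<in>multipliers T. dual_function E net \<epsilon> T lam)"

definition dual_maximizer ::
  "((('n, 'm) datum \<Rightarrow> real) \<Rightarrow> real) \<Rightarrow> ('p, 'n::finite, 'm) net \<Rightarrow> real \<Rightarrow> nat \<Rightarrow> (nat \<Rightarrow> real) \<Rightarrow> bool" where
  "dual_maximizer E net \<epsilon> T lam \<longleftrightarrow> lam \<in> multipliers T \<and>
     (\<forall>\<mu>\<in>multipliers T. dual_function E net \<epsilon> T \<mu> \<le> dual_function E net \<epsilon> T lam)"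

text \<open>First-order stationarity for the max-min problem: the gradient in the parameters of every
  layer vanishes, and no feasible direction increases the Lagrangian in the multipliers, whose
  partial derivatives are the slacks.\<close>

definition stationary_point ::
  "((('n, 'm) datum \<Rightarrow> real) \<Rightarrow> real) \<Rightarrow> ('p::euclidean_space, 'n::finite, 'm) net \<Rightarrow> real \<Rightarrow> nat \<Rightarrow>
   'p params \<Rightarrow> (nat \<Rightarrow> real) \<Rightarrow> bool" where
  "stationary_point E net \<epsilon> T W lam \<longleftrightarrow>
     lam \<in> multipliers T \<and>
     (\<forall>t\<in>{1..T}. ((\<lambda>w. lagrangian E net \<epsilon> T (W(t := w)) lam) has_derivative (\<lambda>_. 0)) (at (W t))) \<and>
     (\<forall>\<mu>\<in>multipliers T. (\<Sum>t=1..T. (\<mu> t - lam t) * slack E net \<epsilon> W t) \<le> 0)"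

text \<open>The trained parameters \<open>W\<close>, the multipliers and the empirical mean \<open>Ehat\<close> depend on the
  random training set; \<open>E\<close> is evaluated at the realised parameters.\<close>

definition near_optimal ::
  "'w measure \<Rightarrow> ((('n, 'm) datum \<Rightarrow> real) \<Rightarrow> real) \<Rightarrow> ('w \<Rightarrow> (('n, 'm) datum \<Rightarrow> real) \<Rightarrow> real) \<Rightarrow>
   ('p::euclidean_space, 'n::finite, 'm) net \<Rightarrow> real \<Rightarrow> nat \<Rightarrow> real \<Rightarrow> real \<Rightarrow> real \<Rightarrow> real \<Rightarrow> real \<Rightarrow>
   ('w \<Rightarrow> 'p params) \<Rightarrow> bool" where
  "near_optimal M E Ehat net \<epsilon> T I \<nu> \<gamma> z \<delta> W \<longleftrightarrow>
     (\<exists>lam lambar.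
        (AE \<omega> in M. stationary_point (Ehat \<omega>) net \<epsilon> T (W \<omega>) (lam \<omega>)) \<and>
        dual_maximizer E net \<epsilon> T lambar \<and>
        (AE \<omega> in M. max (L2_set (lam \<omega>) {1..T}) (L2_set lambar {1..T}) \<le> \<gamma>) \<and>
        with_prob M (1 - \<delta>) (\<lambda>\<omega>.
          \<bar>primal_value E net \<epsilon> T - dual_value (Ehat \<omega>) net \<epsilon> T\<bar> \<le> I * \<nu> + \<gamma> * z \<and>
          (\<forall>t\<in>{1..T}. slack E net \<epsilon> (W \<omega>) t \<le> z)))"

end

theory Submission
  imports Defs
begin

text \<open>The descent constraint at layer \<open>t\<close> fails with probability at most \<open>\<delta>\<close>, where the error is still
  at most \<open>C\<close>. Hence the mean errors satisfy \<open>e\<^sub>t \<le> (1 - \<epsilon>) e\<^sub>t\<^sub>-\<^sub>1 + \<delta> C\<close> when \<open>\<epsilon> \<le> 1\<close>, and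
  iterating this gives the limit bound \<open>\<delta> C / \<epsilon>\<close>, which is below the claimed one. The case
  \<open>\<epsilon> > 1\<close> is excluded by strict feasibility, since the slacks are then nonnegative.\<close>

text \<open>\<open>c / \<epsilon>\<close> is the fixed point of
  \<open>x \<mapsto> (1 - \<epsilon>) * x + c\<close>, and each step shrinks the excess over it by
  the factor \<open>1 - \<epsilon>\<close>. This factor is nonnegative by
  \<open>\<epsilon> \<le> 1\<close>, so the induction hypothesis can be multiplied by it.\<close>

lemma affine_recursion_bound:
  fixes e :: "nat \<Rightarrow> real"
  assumes "0 < \<epsilon>" "\<epsilon> \<le> 1" and "\<And>t. e (Suc t) \<le> (1 - \<epsilon>) * e t + c"
  shows "e t \<le> (1 - \<epsilon>) ^ t * (e 0 - c / \<epsilon>) + c / \<epsilon>"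
proof (induction t)
  case (Suc t)
  have "e (Suc t) \<le> (1 - \<epsilon>) * ((1 - \<epsilon>) ^ t * (e 0 - c / \<epsilon>) + c / \<epsilon>) + c"
    using assms(3)[of t] mult_left_mono[OF Suc, of "1 - \<epsilon>"] assms(2) by linarith
  also have "\<dots> = (1 - \<epsilon>) ^ Suc t * (e 0 - c / \<epsilon>) + c / \<epsilon>"
    using assms(1) by (simp add: field_simps)
  finally show ?case .
qed simp

context prob_space
begin

text \<open>Integrate a pointwise bound: on the good event \<open>f \<le> q * g\<close>, and off it
  \<open>f \<le> C\<close> while \<open>q * g\<close> is nonnegative, so
  \<open>f \<le> q * g + C * indicator (space M - S)\<close> almost everywhere.\<close>

lemma expectation_contraction_with_prob:
  fixes f g :: "'a \<Rightarrow> real"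
  assumes [measurable]: "f \<in> borel_measurable M" "g \<in> borel_measurable M"
    and nonneg: "\<And>\<omega>. 0 \<le> f \<omega>" "\<And>\<omega>. 0 \<le> g \<omega>"
    and f: "AE \<omega> in M. f \<omega> \<le> C" and g: "AE \<omega> in M. g \<omega> \<le> C" and "0 \<le> q"
    and contr: "with_prob M (1 - \<delta>) (\<lambda>\<omega>. f \<omega> \<le> q * g \<omega>)"
  shows "expectation f \<le> q * expectation g + \<delta> * C"
proof -
  \<comment> \<open>A constant inequality that holds almost everywhere in a probability space holds
    outright.\<close>
  have "AE \<omega> in M. 0 \<le> C"
    using f by eventually_elim (use nonneg order_trans in blast)
  then have "0 \<le> C" by simp
  obtain S where [measurable]: "S \<in> events" and S: "1 - \<delta> \<le> prob S" "\<forall>\<omega>\<in>S. f \<omega> \<le> q * g \<omega>"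
    using contr unfolding with_prob_def by auto
  have int: "integrable M f" "integrable M g"
    using f g nonneg by (auto intro!: integrable_const_bound[where B = C])
  have int_ind: "integrable M (indicat_real (space M - S))"
    by (rule integrable_const_bound[where B = 1]) auto
  have "expectation f \<le> expectation (\<lambda>\<omega>. q * g \<omega> + C * indicator (space M - S) \<omega>)"
  proof (rule integral_mono_AE)
    show "AE \<omega> in M. f \<omega> \<le> q * g \<omega> + C * indicator (space M - S) \<omega>"
      using f AE_space
    proof eventually_elim
      case (elim \<omega>)
      then show ?case
        using S(2) nonneg(2)[of \<omega>] \<open>0 \<le> q\<close> by (cases "\<omega> \<in> S") (auto simp: add_increasing)
    qed
  qed (intro int int_ind Bochner_Integration.integrable_add integrable_mult_right)+
  also have "\<dots> = q * expectation g + C * prob (space M - S)"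
    using int int_ind by simp
  also have "\<dots> \<le> q * expectation g + C * \<delta>"
    using S(1) \<open>0 \<le> C\<close> by (intro add_left_mono mult_left_mono) (auto simp: prob_compl)
  finally show ?thesis by (simp add: mult.commute)
qed

text \<open>The running minimum decreases in \<open>t\<close> and is nonnegative, so its means
  converge. It is at most the latest term, whose mean obeys the affine recursion with
  \<open>c = \<delta> * C\<close>.\<close>

lemma expectation_Min_tendsto_of_contraction_with_prob:
  fixes D :: "nat \<Rightarrow> 'a \<Rightarrow> real"
  assumes "0 < \<epsilon>" "\<epsilon> \<le> 1"
    and D[measurable]: "\<And>t. D t \<in> borel_measurable M"
    and nonneg: "\<And>t \<omega>. 0 \<le> D t \<omega>"
    and bound: "\<And>t. AE \<omega> in M. D t \<omega> \<le> C"
    and contr: "\<And>t. with_prob M (1 - \<delta>) (\<lambda>\<omega>. D (Suc t) \<omega> \<le> (1 - \<epsilon>) * D t \<omega>)"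
  shows "\<exists>l. (\<lambda>t. expectation (\<lambda>\<omega>. MIN k\<in>{..t}. D k \<omega>)) \<longlonglongrightarrow> l \<and> l \<le> \<delta> * C / \<epsilon>"
proof -
  let ?m = "\<lambda>t \<omega>. MIN k\<in>{..t}. D k \<omega>"
  have [measurable]: "?m t \<in> borel_measurable M" for t
    by (intro borel_measurable_Min) auto
  have int: "integrable M (D t)" for t
    using bound[of t] nonneg by (auto intro!: integrable_const_bound[where B = C])
  have m_le: "?m t \<omega> \<le> D t \<omega>" for t \<omega>
    by (rule Min_le) auto
  have m_nonneg: "0 \<le> ?m t \<omega>" for t \<omega>
    using nonneg by (subst Min_ge_iff) auto
  have int_m: "integrable M (?m t)" for t
    by (rule Bochner_Integration.integrable_bound[OF int[of t]]) (use m_le m_nonneg nonneg in auto)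
  have "0 \<le> expectation (?m t)" for t
    using m_nonneg by (rule Bochner_Integration.integral_nonneg)
  moreover have "decseq (\<lambda>t. expectation (?m t))"
    by (intro decseq_SucI integral_mono int_m Min_antimono) auto
  ultimately obtain l where l: "(\<lambda>t. expectation (?m t)) \<longlonglongrightarrow> l"
    using decseq_convergent by blast
  have "expectation (D (Suc t)) \<le> (1 - \<epsilon>) * expectation (D t) + \<delta> * C" for t
    using assms by (intro expectation_contraction_with_prob) auto
  then have "expectation (D t)
      \<le> (1 - \<epsilon>) ^ t * (expectation (D 0) - \<delta> * C / \<epsilon>) + \<delta> * C / \<epsilon>" for t
    by (rule affine_recursion_bound[OF assms(1,2)])
  moreover have "expectation (?m t) \<le> expectation (D t)" for t
    by (intro integral_mono int int_m m_le)
  ultimately have le: "expectation (?m t)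
      \<le> (1 - \<epsilon>) ^ t * (expectation (D 0) - \<delta> * C / \<epsilon>) + \<delta> * C / \<epsilon>" for t
    using order_trans by blast
  \<comment> \<open>As \<open>0 \<le> 1 - \<epsilon> < 1\<close>, the contribution of the initial
    error vanishes.\<close>
  have "(\<lambda>t. (1 - \<epsilon>) ^ t * (expectation (D 0) - \<delta> * C / \<epsilon>) + \<delta> * C / \<epsilon>)
      \<longlonglongrightarrow> 0 * (expectation (D 0) - \<delta> * C / \<epsilon>) + \<delta> * C / \<epsilon>"
    by (intro tendsto_intros LIMSEQ_power_zero) (use assms(1,2) in auto)
  then have "l \<le> \<delta> * C / \<epsilon>"
    using LIMSEQ_le[OF l] le by auto
  with l show ?thesis by blast
qed

end

text \<open>The previous error enters with the factor \<open>-(1 - \<epsilon>) \<ge> 0\<close>, so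
  the integrand is nonnegative pointwise. This will contradict strict feasibility.\<close>

lemma slack_population_nonneg:
  assumes "1 \<le> \<epsilon>"
  shows "0 \<le> slack (population M Z) net \<epsilon> w t"
  unfolding slack_def population_def descent_def
proof (rule Bochner_Integration.integral_nonneg)
  fix \<omega>
  have "(1 - \<epsilon>) * r \<le> 0" if "0 \<le> r" for r
    using assms that by (simp add: mult_nonpos_nonneg)
  then show "0 \<le> (case Z \<omega> of (g, x) \<Rightarrow> norm (net w t x - g) - (1 - \<epsilon>) * norm (net w (t - 1) x - g))"
    by (auto split: prod.split intro: order_trans[OF _ norm_ge_zero])
qed

theorem theorem2:
  fixes M :: "'w measure" and F :: "nat \<Rightarrow> 'w measure"
    and A :: "real^'n^'m" and H :: "(real^'n) set"
    and h h0 :: "'w \<Rightarrow> real^'n" and n y :: "'w \<Rightarrow> real^'m"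
    and \<eta> :: "nat \<Rightarrow> 'w \<Rightarrow> real^'n" and \<sigma> :: "nat \<Rightarrow> real"
    and N :: "'p::euclidean_space \<Rightarrow> real^'n \<Rightarrow> real^'n"
    and net :: "('p, 'n, 'm) net"
    and inp :: "'w \<Rightarrow> ('n, 'm) input"
    and K :: "real^'n \<Rightarrow> ('n, 'm) input measure"
    and tr :: "nat \<Rightarrow> 'w \<Rightarrow> ('n, 'm) datum" and J :: nat
    and E :: "(('n, 'm) datum \<Rightarrow> real) \<Rightarrow> real"
    and X :: "(real^'n) set" and Pbar :: "nat \<Rightarrow> (('n, 'm) input \<Rightarrow> real^'n) set"
    and \<zeta> :: "nat \<Rightarrow> real \<Rightarrow> real" and \<nu> \<gamma> :: "nat \<Rightarrow> real"
    and \<epsilon> \<delta> I C :: real and W :: "'w \<Rightarrow> 'p params"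
  assumes "0 < \<epsilon>" and "0 < \<delta>" and "\<delta> < 1"
    \<comment> \<open>measurement model\<close>
    and "prob_space M"
    and "h \<in> borel_measurable M" and "\<forall>\<omega>\<in>space M. h \<omega> \<in> H"
    and "n \<in> borel_measurable M" and "is_gaussian (distr M borel n)"
    and "y = (\<lambda>\<omega>. A *v h \<omega> + n \<omega>)"
    \<comment> \<open>unrolled network\<close>
    and "\<forall>\<theta>. N \<theta> \<in> borel_measurable borel"
    and "h0 \<in> borel_measurable M"
    and "\<forall>t. \<eta> t \<in> borel_measurable M"
    and "\<forall>t\<ge>1. distr M borel (\<eta> t) = isotropic_gaussian (\<sigma> t)"
    and "\<forall>t\<ge>1. 0 \<le> \<sigma> (Suc t) \<and> \<sigma> (Suc t) \<le> \<sigma> t"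
    and "net = network N A"
    and "inp = (\<lambda>\<omega>. (h0 \<omega>, y \<omega>, \<lambda>t. \<eta> t \<omega>))"
    and "filtration (space M) F" and "\<forall>t. sets (F t) \<subseteq> sets M"
    and "\<forall>w t. (\<lambda>\<omega>. net w t (inp \<omega>)) \<in> borel_measurable (F t)"
    \<comment> \<open>population mean and training samples\<close>
    and "E = population M (\<lambda>\<omega>. (h \<omega>, inp \<omega>))"
    and "0 < J"
    and "\<forall>j. tr j \<in> M \<rightarrow>\<^sub>M borel \<Otimes>\<^sub>M input_space"
    and "\<forall>j. \<forall>\<omega>\<in>space M. fst (tr j \<omega>) \<in> H"
    and "\<forall>j. distr M (borel \<Otimes>\<^sub>M input_space) (tr j) =
             distr M (borel \<Otimes>\<^sub>M input_space) (\<lambda>\<omega>. (h \<omega>, inp \<omega>))"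
    \<comment> \<open>Assumption 1, on the set of all layer outputs\<close>
    and "X = {net w t x | w t x. x \<in> inp ` space M \<union> (\<Union>j. (snd \<circ> tr j) ` space M)}"
    and "\<forall>g\<in>H. bounded ((\<lambda>x. loss x g) ` X) \<and> I-lipschitz_on X (\<lambda>x. loss x g)"
    and "\<forall>g\<in>H. \<forall>x'. bounded ((\<lambda>x. descent \<epsilon> g x x') ` X) \<and>
                      I-lipschitz_on X (\<lambda>x. descent \<epsilon> g x x')"
    \<comment> \<open>Assumption 2\<close>
    and "Pbar = (\<lambda>t. closed_conv_maps M inp input_space (compositions net t))"
    and "\<forall>t\<ge>1. \<forall>\<Phi>\<in>Pbar t. \<forall>r>0. \<exists>w.
           (\<integral>\<^sup>+\<omega>. ennreal (norm (net w t (inp \<omega>) - \<Phi> (inp \<omega>))) \<partial>M) \<le> ennreal r"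
    \<comment> \<open>Assumption 3\<close>
    and "compact H"
    and "cond_distribution M borel input_space h inp K"
    and "\<forall>g\<in>H. nonatomic (distr (K g) borel (\<lambda>(x0, y, \<eta>). y))"
    and "\<forall>t\<ge>1. \<forall>\<Phi>\<in>Pbar t.
           tv_uniformly_continuous_on H input_space K (\<lambda>g x. loss (\<Phi> x) g) \<and>
           tv_uniformly_continuous_on H input_space K (\<lambda>g x. descent \<epsilon> g (\<Phi> x) g)"
    \<comment> \<open>Assumption 4\<close>
    and "\<forall>k d. 0 \<le> \<zeta> k d"
    and "\<forall>d. \<forall>k\<ge>1. \<forall>k'\<ge>k. \<zeta> k' d \<le> \<zeta> k d"
    and "\<forall>k\<ge>1. \<forall>d\<in>{0<..<1}. \<forall>T\<ge>1. \<forall>w. with_prob M (1 - d) (\<lambda>\<omega>.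
           \<bar>risk E net T w - risk (empirical k tr \<omega>) net T w\<bar> \<le> \<zeta> k d \<and>
           (\<forall>t\<in>{1..T}. \<bar>slack E net \<epsilon> w t - slack (empirical k tr \<omega>) net \<epsilon> w t\<bar> \<le> \<zeta> k d))"
    \<comment> \<open>Assumption 5\<close>
    and "\<forall>T\<ge>1. 0 < \<nu> T"
    and "\<forall>T\<ge>1. AE \<omega> in M. \<exists>w. \<exists>\<xi>>0. \<forall>t\<in>{1..T}.
           slack E net \<epsilon> w t \<le> - I * \<nu> T - \<xi> \<and> slack (empirical J tr \<omega>) net \<epsilon> w t \<le> - \<xi>"
    \<comment> \<open>near-optimal trained parameters satisfying the descent constraint\<close>
    and "\<forall>T\<ge>1. near_optimal M E (empirical J tr) net \<epsilon> T I (\<nu> T) (\<gamma> T) (\<zeta> J \<delta>) \<delta> W"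
    and "AE \<omega> in M. \<forall>t\<ge>1. with_prob M (1 - \<delta>) (\<lambda>\<omega>'.
           descent \<epsilon> (h \<omega>') (net (W \<omega>) t (inp \<omega>')) (net (W \<omega>) (t - 1) (inp \<omega>')) \<le> 0)"
    and "AE \<omega> in M. \<forall>t. AE \<omega>' in M. norm (net (W \<omega>) t (inp \<omega>') - h \<omega>') \<le> C"
  shows "AE \<omega> in M. \<exists>l.
           (\<lambda>t. \<integral>\<omega>'. (MIN k\<in>{..t}. norm (net (W \<omega>) k (inp \<omega>') - h \<omega>')) \<partial>M) \<longlonglongrightarrow> l \<and>
           l \<le> 1 / \<epsilon> * (\<zeta> J \<delta> + \<delta> * C / (1 - \<delta>))"
proof -
  interpret prob_space M by fact
  \<comment> \<open>A point of \<open>H\<close> is wanted to instantiate the Lipschitz assumption,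
    which contains \<open>0 \<le> I\<close>.\<close>
  have "H \<noteq> {}"
    using \<open>\<forall>\<omega>\<in>space M. h \<omega> \<in> H\<close> not_empty by blast
  then have "0 \<le> I"
    using \<open>\<forall>g\<in>H. bounded ((\<lambda>x. loss x g) ` X) \<and> I-lipschitz_on X (\<lambda>x. loss x g)\<close>
      lipschitz_on_nonneg by blast
  have "\<epsilon> \<le> 1"
  proof (rule ccontr)
    assume "\<not> \<epsilon> \<le> 1"
    then have slack: "0 \<le> slack E net \<epsilon> w t" for w t
      unfolding \<open>E = population M (\<lambda>\<omega>. (h \<omega>, inp \<omega>))\<close>
      by (intro slack_population_nonneg) simp
    \<comment> \<open>Strict feasibility is taken for a single layer, \<open>T = 1\<close>. The
      population slack does not depend on the training outcome, so the almost sure statement yields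
      one fixed witness.\<close>
    have "AE \<omega> in M. \<exists>w. \<exists>\<xi>>0. slack E net \<epsilon> w 1 \<le> - I * \<nu> 1 - \<xi>"
      using assms(38)[rule_format, OF order_refl] by eventually_elim auto
    then obtain w \<xi> where "0 < \<xi>" "slack E net \<epsilon> w 1 \<le> - I * \<nu> 1 - \<xi>"
      by auto
    moreover have "0 \<le> I * \<nu> 1"
      using \<open>0 \<le> I\<close> \<open>\<forall>T\<ge>1. 0 < \<nu> T\<close> by (simp add: less_imp_le)
    ultimately show False
      using slack[of w 1] by simp
  qed
  have [measurable]: "h \<in> borel_measurable M" by fact
  \<comment> \<open>Adaptedness gives measurability for \<open>F t\<close>, a sub-\<sigma>-algebra
    of \<open>M\<close> on the same space.\<close>
  have net [measurable]: "(\<lambda>\<omega>. net w t (inp \<omega>)) \<in> borel_measurable M" for w t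
    using \<open>\<forall>w t. (\<lambda>\<omega>. net w t (inp \<omega>)) \<in> borel_measurable (F t)\<close> \<open>\<forall>t. sets (F t) \<subseteq> sets M\<close>
      \<open>filtration (space M) F\<close> filtration.space_F
    by (metis measurable_mono order_refl subset_iff)
  \<comment> \<open>Two outcomes are kept apart: \<open>\<omega>\<close> fixes the trained
    parameters, and \<open>\<omega>'\<close> is the outcome averaged over. For almost every
    \<open>\<omega>\<close> the convergence lemma is applied in \<open>\<omega>'\<close> with
    \<open>W \<omega>\<close> frozen.\<close>
  show ?thesis
    using assms(40,41)
  proof eventually_elim
    case (elim \<omega>)
    have "\<exists>l. (\<lambda>t. expectation (\<lambda>\<omega>'. MIN k\<in>{..t}. norm (net (W \<omega>) k (inp \<omega>') - h \<omega>')))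
        \<longlonglongrightarrow> l \<and> l \<le> \<delta> * C / \<epsilon>"
    proof (rule expectation_Min_tendsto_of_contraction_with_prob)
      fix t
      show "with_prob M (1 - \<delta>) (\<lambda>\<omega>'. norm (net (W \<omega>) (Suc t) (inp \<omega>') - h \<omega>')
          \<le> (1 - \<epsilon>) * norm (net (W \<omega>) t (inp \<omega>') - h \<omega>'))"
        \<comment> \<open>Layers are numbered from 1, so the constraint at layer
          \<open>Suc t\<close> relates the outputs \<open>Suc t\<close> and
          \<open>t\<close>.\<close>
        using elim(1)[rule_format, of "Suc t"] by (simp add: descent_def)
    qed (use \<open>0 < \<epsilon>\<close> \<open>\<epsilon> \<le> 1\<close> elim in auto)
    \<comment> \<open>The claimed bound is weaker: since \<open>0 \<le> C\<close>, dividing by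
      \<open>1 - \<delta>\<close>, which lies between 0 and 1, only enlarges
      \<open>\<delta> * C\<close>, and \<open>\<zeta> J \<delta>\<close> is nonnegative.\<close>
    moreover have "\<delta> * C / \<epsilon> \<le> 1 / \<epsilon> * (\<zeta> J \<delta> + \<delta> * C / (1 - \<delta>))"
    proof -
      have "AE \<omega>' in M. 0 \<le> C"
        using elim(2)[rule_format, of 0] by eventually_elim (use norm_ge_zero order_trans in blast)
      then have "0 \<le> C" by simp
      then have "\<delta> * C \<le> \<delta> * C / (1 - \<delta>)"
        using \<open>0 < \<delta>\<close> \<open>\<delta> < 1\<close> by (simp add: pos_le_divide_eq mult_left_le)
      then have "\<delta> * C \<le> \<zeta> J \<delta> + \<delta> * C / (1 - \<delta>)"
        using \<open>\<forall>k d. 0 \<le> \<zeta> k d\<close> by (simp add: add_increasing)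
      then show ?thesis
        using \<open>0 < \<epsilon>\<close> by (simp add: divide_right_mono)
    qed
    ultimately show ?case
      using order_trans by blast
  qed
qed

end
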